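(* Let $q\in\mathbb{N}$ and let $T$ be a $(q+1)$-homogeneous tree rooted at $o$. Then every self map $\phi:T\to T$ induces a bounded composition operator $C_\phi$ on $\mathbb{T}_\infty$, and $\|C_\phi\|=1$.
   Context: $\mathbb{N}=\{1,2,\ldots\}$, $\mathbb{N}_0=\mathbb{N}\cup\{0\}$. A $(q+1)$-homogeneous tree is an (infinite) connected graph without cycles in which every vertex has exactly $q+1$ neighbours; it is rooted at a fixed vertex $o$. We identify $T$ with its vertex set, and $|v|$ denotes the number of edges in the unique path from $o$ to $v$. A self map of $T$ is an arbitrary function $\phi:T\to T$ on vertices. For $f:T\to\mathbb{C}$ put $M_\infty(n,f)=\max_{|v|=n}|f(v)|$ for $n\in\mathbb{N}_0$, and $\|f\|_\infty=\sup_{n\in\mathbb{N}_0}M_\infty(n,f)$. The space is $\mathbb{T}_\infty=\{f:T\to\mathbb{C} : \|f\|_\infty<\infty\}$. The composition operator is $C_\phi f=f\circ\phi$. Its operator norm is $\|C_\phi\|=\sup\{\|f\circ\phi\|_\infty : \|f\|_\infty=1\}$, and $C_\phi$ is bounded on $\mathbb{T}_\infty$ if it maps $\mathbb{T}_\infty$ into itself and $\|C_\phi\|<\infty$. *)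

theory Defs
  imports Complex_Main "HOL-Library.Extended_Real"
begin

text \<open>
  A graph is given by its adjacency relation; its vertex set is the whole type \<open>'a\<close>,
  so that functions and self maps on the tree are plain HOL functions on \<open>'a\<close>.
\<close>

definition simple_path :: "('a \<Rightarrow> 'a \<Rightarrow> bool) \<Rightarrow> 'a \<Rightarrow> 'a list \<Rightarrow> 'a \<Rightarrow> bool" where
  "simple_path E u p v \<longleftrightarrow>
     p \<noteq> [] \<and> hd p = u \<and> last p = v \<and> distinct p \<and> successively E p"

text \<open>The length bound keeps a single edge, traversed back and forth, from being a cycle.\<close>

definition graph_cycle :: "('a \<Rightarrow> 'a \<Rightarrow> bool) \<Rightarrow> 'a list \<Rightarrow> bool" where
  "graph_cycle E p \<longleftrightarrow>
     length p \<ge> 3 \<and> distinct p \<and> successively E p \<and> E (last p) (hd p)"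

text \<open>
  For \<open>d \<ge> 2\<close> such a tree is automatically infinite. For \<open>d \<ge> 1\<close> the cardinality
  condition includes finiteness of the set of neighbours.
\<close>

definition homogeneous_tree :: "nat \<Rightarrow> ('a \<Rightarrow> 'a \<Rightarrow> bool) \<Rightarrow> bool" where
  "homogeneous_tree d E \<longleftrightarrow>
     symp E \<and> irreflp E \<and> (\<forall>u v. E\<^sup>*\<^sup>* u v) \<and> (\<nexists>p. graph_cycle E p) \<and>
     (\<forall>v. card {w. E v w} = d)"

text \<open>A path listed by its vertices has one edge fewer than vertices.\<close>

definition tree_length :: "('a \<Rightarrow> 'a \<Rightarrow> bool) \<Rightarrow> 'a \<Rightarrow> 'a \<Rightarrow> nat" where
  "tree_length E v0 v = length (THE p. simple_path E v0 p v) - 1"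

definition M_inf :: "('a \<Rightarrow> 'a \<Rightarrow> bool) \<Rightarrow> 'a \<Rightarrow> nat \<Rightarrow> ('a \<Rightarrow> complex) \<Rightarrow> real" where
  "M_inf E v0 n f = Max {cmod (f v) | v. tree_length E v0 v = n}"

definition norm_inf :: "('a \<Rightarrow> 'a \<Rightarrow> bool) \<Rightarrow> 'a \<Rightarrow> ('a \<Rightarrow> complex) \<Rightarrow> ereal" where
  "norm_inf E v0 f = (SUP n. ereal (M_inf E v0 n f))"

definition T_inf :: "('a \<Rightarrow> 'a \<Rightarrow> bool) \<Rightarrow> 'a \<Rightarrow> ('a \<Rightarrow> complex) set" where
  "T_inf E v0 = {f. norm_inf E v0 f < \<infinity>}"

definition comp_op :: "('a \<Rightarrow> 'a) \<Rightarrow> ('a \<Rightarrow> complex) \<Rightarrow> 'a \<Rightarrow> complex" where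
  "comp_op \<phi> f = f \<circ> \<phi>"

definition op_norm_inf ::
    "('a \<Rightarrow> 'a \<Rightarrow> bool) \<Rightarrow> 'a \<Rightarrow> (('a \<Rightarrow> complex) \<Rightarrow> ('a \<Rightarrow> complex)) \<Rightarrow> ereal" where
  "op_norm_inf E v0 A = (SUP f\<in>{f. norm_inf E v0 f = 1}. norm_inf E v0 (A f))"

definition bounded_on_T_inf ::
    "('a \<Rightarrow> 'a \<Rightarrow> bool) \<Rightarrow> 'a \<Rightarrow> (('a \<Rightarrow> complex) \<Rightarrow> ('a \<Rightarrow> complex)) \<Rightarrow> bool" where
  "bounded_on_T_inf E v0 A \<longleftrightarrow> A ` T_inf E v0 \<subseteq> T_inf E v0 \<and> op_norm_inf E v0 A < \<infinity>"

end

theory Submission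
  imports Defs
begin

text \<open>
  Every sphere \<open>{v. |v| = n}\<close> is finite and nonempty, so \<open>\<parallel>f\<parallel>\<close> is the supremum of
  \<open>|f v|\<close> over all vertices \<open>v\<close>, and precomposing \<open>f\<close> with \<open>\<phi>\<close> only restricts this
  supremum to the range of \<open>\<phi>\<close>. The constant function 1 shows that the bound 1 is attained.
\<close>

text \<open>Induction along the walk: a new end vertex is appended, unless it already lies on the
  path, which is then cut off at that vertex.\<close>

lemma simple_path_exists:
  assumes "E\<^sup>*\<^sup>* u v"
  shows "\<exists>p. simple_path E u p v"
  using assms
proof (induction rule: rtranclp_induct)
  case base
  have "simple_path E u [u] u" by (simp add: simple_path_def)
  then show ?case ..
next
  case (step y z)
  then obtain p where p: "simple_path E u p y" by blast
  show ?case
  proof (cases "z \<in> set p")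
    case True
    then obtain as bs where "p = as @ z # bs" by (meson split_list)
    with p have "simple_path E u (as @ [z]) z"
      by (auto simp: simple_path_def successively_append_iff hd_append)
    then show ?thesis ..
  next
    case False
    with p step.hyps(2) have "simple_path E u (p @ [z]) z"
      by (auto simp: simple_path_def successively_append_iff)
    then show ?thesis ..
  qed
qed

text \<open>Common first edges are stripped by the induction. Where the paths diverge, following one
  until it first meets the other and returning along the other closes a cycle.\<close>

lemma simple_path_unique:
  assumes "symp E" and acyclic: "\<nexists>p. graph_cycle E p"
  shows "simple_path E u p v \<Longrightarrow> simple_path E u p' v \<Longrightarrow> p = p'"
proof (induction p arbitrary: u p')
  case Nil
  then show ?case by (simp add: simple_path_def)
next
  case (Cons x ps)
  from Cons.prems have [simp]: "x = u" by (simp add: simple_path_def)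
  from Cons.prems(2) obtain ps' where p': "p' = u # ps'"
    by (cases p') (auto simp: simple_path_def)
  show ?case
  proof (cases "ps = [] \<or> ps' = []")
    \<comment> \<open>An empty tail forces \<open>v = u\<close>; a nonempty other tail would end in
      \<open>u\<close> again, against distinctness.\<close>
    case True
    with Cons.prems p' show ?thesis
      by (auto simp: simple_path_def split: if_splits)
  next
    case False
    then have ne: "ps \<noteq> []" "ps' \<noteq> []" by auto
    from Cons.prems(1) ne have ps: "simple_path E (hd ps) ps v" "u \<notin> set ps" "E u (hd ps)"
      by (auto simp: simple_path_def successively_Cons)
    from Cons.prems(2) p' ne have ps': "simple_path E (hd ps') ps' v" "u \<notin> set ps'" "E u (hd ps')"
      by (auto simp: simple_path_def successively_Cons)
    show ?thesis
    proof (cases "hd ps = hd ps'")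
      case True
      with Cons.IH[OF ps(1)] ps'(1) p' show ?thesis by simp
    next
      case neq: False
      have "v \<in> set ps" "v \<in> set ps'"
        using ps(1) ps'(1) unfolding simple_path_def by (metis last_in_set)+
      then have "\<exists>z\<in>set ps. z \<in> set ps'" by blast
      \<comment> \<open>Taking the first meeting vertex \<open>z\<close> keeps \<open>xs\<close>
        disjoint from \<open>ps'\<close>, so the closed path below has no repetition.\<close>
      then obtain xs z ys where z: "ps = xs @ z # ys" "z \<in> set ps'" "\<forall>y\<in>set xs. y \<notin> set ps'"
        using split_list_first_prop[of ps "\<lambda>z. z \<in> set ps'"] by auto
      from z(2) obtain xs' ys' where z': "ps' = xs' @ z # ys'" by (meson split_list)
      have flip: "E a b" if "E b a" for a b using that \<open>symp E\<close> by (rule sympD[rotated])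
      \<comment> \<open>Since the heads of the tails differ, \<open>xs\<close> and
        \<open>xs'\<close> cannot both be empty.\<close>
      have "length (u # xs @ z # rev xs') \<ge> 3"
        using neq z(1) z' by (cases xs; cases xs') auto
      moreover have "distinct (u # xs @ z # rev xs')"
        using ps ps' z z' by (auto simp: simple_path_def)
      moreover have "successively E (u # xs @ [z])"
        using ps(1,3) z(1)
        by (cases xs) (auto simp: simple_path_def successively_append_iff successively_Cons hd_append)
      moreover have "successively E (z # rev xs')"
      proof -
        have "successively E (xs' @ [z])"
          using ps'(1) z' by (auto simp: simple_path_def successively_append_iff)
        then have "successively (\<lambda>x y. E y x) (rev (xs' @ [z]))"
          by (simp only: successively_rev)
        then have "successively E (rev (xs' @ [z]))"
          by (rule successively_mono) (rule flip)
        then show ?thesis by simp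
      qed
      moreover have "E (last (z # rev xs')) u"
        using flip[OF ps'(3)] z' by (cases xs') auto
      ultimately have "graph_cycle E (u # xs @ z # rev xs')"
        by (auto simp: graph_cycle_def successively_append_iff successively_Cons hd_append)
      with acyclic show ?thesis by blast
    qed
  qed
qed

lemma tree_length_eq:
  assumes "symp E" "\<nexists>p. graph_cycle E p" "simple_path E u p v"
  shows "tree_length E u v = length p - 1"
proof -
  have "(THE p. simple_path E u p v) = p"
    using assms(3) simple_path_unique[OF assms(1,2) _ assms(3)] by (rule the_equality)
  then show ?thesis by (simp add: tree_length_def)
qed

text \<open>Walks may repeat vertices, so the tail of a walk is again an arbitrary walk from a
  neighbour, and finite branching gives finiteness by induction.\<close>

lemma finite_walks:
  assumes "\<And>v. finite {w. E v w}"
  shows "finite {p. length p = n \<and> p \<noteq> [] \<and> hd p = u \<and> successively E p}"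
proof (induction n arbitrary: u)
  case 0
  then show ?case by simp
next
  case (Suc n)
  let ?W = "\<lambda>u. {p. length p = n \<and> p \<noteq> [] \<and> hd p = u \<and> successively E p}"
  \<comment> \<open>The singleton \<open>[u]\<close> is listed apart because its tail is empty and
    thus in no \<open>?W w\<close>.\<close>
  have "{p. length p = Suc n \<and> p \<noteq> [] \<and> hd p = u \<and> successively E p}
    \<subseteq> insert [u] ((#) u ` (\<Union>w\<in>{w. E u w}. ?W w))" (is "?L \<subseteq> ?R")
  proof
    fix p assume "p \<in> ?L"
    then show "p \<in> ?R"
      by (cases p) (auto simp: successively_Cons)
  qed
  moreover have "finite ?R"
    using Suc.IH assms by auto
  ultimately show ?case by (rule finite_subset)
qed

lemma homogeneous_treeD:
  assumes "homogeneous_tree d E"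
  shows "symp E" "irreflp E" "E\<^sup>*\<^sup>* u v" "\<nexists>p. graph_cycle E p" "card {w. E v w} = d"
  using assms by (auto simp: homogeneous_tree_def)

text \<open>A vertex at distance \<open>n\<close> is the last vertex of a walk from \<open>u\<close>
  with \<open>n + 1\<close> vertices, and such walks are finite in number.\<close>

lemma finite_sphere:
  assumes tree: "homogeneous_tree d E" and "d \<ge> 1"
  shows "finite {v. tree_length E u v = n}"
proof -
  note T = homogeneous_treeD[OF tree]
  \<comment> \<open>An infinite set has \<open>card\<close> 0, so a positive degree forces
    finiteness.\<close>
  have fin: "finite {w. E v w}" for v
    using T(5)[of v] \<open>d \<ge> 1\<close> by (intro card_ge_0_finite) simp
  have "{v. tree_length E u v = n}
    \<subseteq> last ` {p. length p = Suc n \<and> p \<noteq> [] \<and> hd p = u \<and> successively E p}"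
  proof
    fix v assume v: "v \<in> {v. tree_length E u v = n}"
    obtain p where p: "simple_path E u p v" using simple_path_exists T(3) by metis
    with v tree_length_eq[OF T(1,4) p] have "length p = Suc n"
      by (cases p) (auto simp: simple_path_def)
    with p show "v \<in> last ` {p. length p = Suc n \<and> p \<noteq> [] \<and> hd p = u \<and> successively E p}"
      by (intro image_eqI[of _ _ p]) (auto simp: simple_path_def)
  qed
  then show ?thesis by (rule finite_subset) (intro finite_imageI finite_walks fin)
qed

text \<open>This makes every sphere nonempty. A path can always be prolonged, since its end has a
  neighbour other than its predecessor; if that neighbour were on the path, there would be two
  simple paths from it to the end.\<close>

lemma simple_path_of_length_exists:
  assumes tree: "homogeneous_tree d E" and "d \<ge> 2"
  shows "\<exists>p v. simple_path E u p v \<and> length p = Suc n"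
proof (induction n)
  case 0
  have "simple_path E u [u] u" by (simp add: simple_path_def)
  then show ?case by (intro exI[of _ "[u]"] exI[of _ u]) simp
next
  case (Suc n)
  note T = homogeneous_treeD[OF tree]
  from Suc obtain p v where p: "simple_path E u p v" "length p = Suc n" by blast
  \<comment> \<open>For \<open>p = [u]\<close> there is no predecessor and
    \<open>last (butlast p)\<close> is an unspecified vertex; avoiding it does no harm.\<close>
  have "\<not> {w. E v w} \<subseteq> {last (butlast p)}"
    using T(5)[of v] \<open>d \<ge> 2\<close> card_mono[of "{last (butlast p)}" "{w. E v w}"] by auto
  then obtain x where x: "E v x" "x \<noteq> last (butlast p)" by auto
  have "x \<noteq> v" using irreflpD[OF T(2)] x(1) by blast
  have "x \<notin> set p"
  proof
    assume "x \<in> set p"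
    then obtain as bs where s: "p = as @ x # bs" by (meson split_list)
    have "simple_path E x (x # bs) v"
      using p s by (auto simp: simple_path_def successively_append_iff)
    moreover have "simple_path E x [x, v] v"
      using sympD[OF T(1) x(1)] \<open>x \<noteq> v\<close> by (simp add: simple_path_def)
    ultimately have "x # bs = [x, v]" by (rule simple_path_unique[OF T(1,4)])
    then have "last (butlast p) = x" using s by (simp add: butlast_append)
    with x(2) show False by simp
  qed
  then have "simple_path E u (p @ [x]) x"
    using p x(1) by (auto simp: simple_path_def successively_append_iff)
  then show ?case using p(2) by (intro exI[of _ "p @ [x]"] exI[of _ x]) simp
qed

lemma norm_inf_eq_SUP:
  assumes tree: "homogeneous_tree d E" and "d \<ge> 2"
  shows "norm_inf E u f = (SUP v. ereal (cmod (f v)))"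
proof -
  note T = homogeneous_treeD[OF tree]
  let ?S = "\<lambda>n. {cmod (f v) | v. tree_length E u v = n}"
  have S: "?S n = (\<lambda>v. cmod (f v)) ` {v. tree_length E u v = n}" for n by auto
  have fin: "finite (?S n)" for n
    unfolding S using finite_sphere[OF tree] \<open>d \<ge> 2\<close> by simp
  have "{v. tree_length E u v = n} \<noteq> {}" for n
  proof -
    obtain p v where p: "simple_path E u p v" "length p = Suc n"
      using simple_path_of_length_exists[OF assms] by blast
    with tree_length_eq[OF T(1,4) p(1)] show ?thesis by auto
  qed
  then have ne: "?S n \<noteq> {}" for n unfolding S by blast
  show ?thesis
  proof (rule antisym)
    show "norm_inf E u f \<le> (SUP v. ereal (cmod (f v)))"
      unfolding norm_inf_def
    proof (rule SUP_least)
      fix n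
      \<comment> \<open>On a finite nonempty sphere the maximum is attained at some vertex.\<close>
      from Max_in[OF fin ne, of n] obtain v where "M_inf E u n f = cmod (f v)"
        by (auto simp: M_inf_def)
      then show "ereal (M_inf E u n f) \<le> (SUP v. ereal (cmod (f v)))"
        by (auto intro: SUP_upper)
    qed
    show "(SUP v. ereal (cmod (f v))) \<le> norm_inf E u f"
    proof (rule SUP_least)
      fix v
      have "cmod (f v) \<le> M_inf E u (tree_length E u v) f"
        unfolding M_inf_def by (rule Max_ge[OF fin]) blast
      then show "ereal (cmod (f v)) \<le> norm_inf E u f"
        unfolding norm_inf_def by (intro SUP_upper2[of "tree_length E u v"]) auto
    qed
  qed
qed

theorem theorem1:
  fixes q :: nat and E :: "'a \<Rightarrow> 'a \<Rightarrow> bool" and v0 :: 'a and \<phi> :: "'a \<Rightarrow> 'a"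
  assumes "q \<ge> 1" and "homogeneous_tree (q + 1) E"
  shows "bounded_on_T_inf E v0 (comp_op \<phi>) \<and> op_norm_inf E v0 (comp_op \<phi>) = 1"
proof -
  have norm: "norm_inf E v0 f = (SUP v. ereal (cmod (f v)))" for f
    using norm_inf_eq_SUP[OF assms(2)] assms(1) by simp
  have le: "norm_inf E v0 (comp_op \<phi> f) \<le> norm_inf E v0 f" for f
    \<comment> \<open>The term at \<open>v\<close> on the left is the term at
      \<open>\<phi> v\<close> on the right.\<close>
    unfolding norm comp_op_def comp_def
    by (rule SUP_mono) blast
  have one: "norm_inf E v0 (\<lambda>_. 1) = 1"
    unfolding norm by (simp add: one_ereal_def)
  have op_norm: "op_norm_inf E v0 (comp_op \<phi>) = 1"
  proof (rule antisym)
    show "op_norm_inf E v0 (comp_op \<phi>) \<le> 1"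
      unfolding op_norm_inf_def using le by (intro SUP_least) (metis mem_Collect_eq)
    have "comp_op \<phi> (\<lambda>_. 1) = (\<lambda>_. 1)" by (auto simp: comp_op_def)
    then show "1 \<le> op_norm_inf E v0 (comp_op \<phi>)"
      unfolding op_norm_inf_def using one by (intro SUP_upper2[of "\<lambda>_. 1"]) auto
  qed
  have "comp_op \<phi> ` T_inf E v0 \<subseteq> T_inf E v0"
    unfolding T_inf_def using le_less_trans[OF le] by blast
  with op_norm show ?thesis by (simp add: bounded_on_T_inf_def)
qed

end
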